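(* Let $\varphi$ be an $\mathcal{ML}$ formula over a finite set $\mathsf{PROP}$ of propositional symbols of modal depth at most $L$. The following are equivalent: (1) $\varphi$ is preserved under injective homomorphisms, i.e. whenever $(\mathfrak{M},w)\models\varphi$ and there is an injective homomorphism from $(\mathfrak{M},w)$ to $(\mathfrak{N},v)$, then $(\mathfrak{N},v)\models\varphi$; (2) $\varphi$ is equivalent (over finite pointed models) to an $\exists^+\mathcal{ML}$ formula of modal depth at most $L$.
   Context: All Kripke models are finite: $\mathfrak{M}=(W,R,V)$, $W$ non-empty finite, $R\subseteq W\times W$, $V:\mathsf{PROP}\to 2^W$; a pointed model is $(\mathfrak{M},w)$. A homomorphism from $(\mathfrak{M},w)$ to $(\mathfrak{N},v)$, $\mathfrak{N}=(W',R',V')$, is $f:W\to W'$ with $f(w)=v$ such that $uRz$ implies $f(u)R'f(z)$ and $u\in V(p)$ implies $f(u)\in V'(p)$; it is an injective homomorphism if $f$ is injective. $\mathcal{ML}$: $\varphi::=p\mid\neg\varphi\mid\varphi\wedge\varphi\mid\varphi\vee\varphi\mid\Diamond\varphi$, $(\mathfrak{M},w)\models\Diamond\varphi$ iff some $u$ with $wRu$ satisfies $\varphi$. Modal depth = maximal nesting of $\Diamond$. $\exists^+\mathcal{ML}$: negation-free fragment. Equivalence means satisfaction by the same finite pointed models.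
   Formalization: The constants ⊤ and ⊥ are added to the grammar, also of ∃⁺ML: without them the claim fails, e.g. p∨¬p is preserved but every negation-free formula fails at an isolated world with empty valuation. Worlds of models are drawn from one fixed infinite set, which covers all finite models up to isomorphism. *)

theory Defs
  imports Main
begin

text \<open>
  The constants \<open>Top\<close> and \<open>Bot\<close> are the empty conjunction and the empty disjunction.  In the full
  language they are definable as soon as there is a propositional symbol, but they are not definable
  in the negation-free fragment: built from symbols, conjunction, disjunction and diamond alone, a
  formula fails at an isolated world with empty valuation and holds at a reflexive world
  satisfying every symbol, although \<open>p \<or> \<not> p\<close> and \<open>p \<and> \<not> p\<close> are both preserved under
  injective homomorphisms.
\<close>

datatype (props: 'p) ml =
    Top
  | Bot
  | Prop 'p
  | Neg "'p ml"
  | Conj "'p ml" "'p ml"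
  | Disj "'p ml" "'p ml"
  | Dia "'p ml"

primrec modal_depth :: "'p ml \<Rightarrow> nat" where
  "modal_depth Top = 0"
| "modal_depth Bot = 0"
| "modal_depth (Prop p) = 0"
| "modal_depth (Neg \<phi>) = modal_depth \<phi>"
| "modal_depth (Conj \<phi> \<psi>) = max (modal_depth \<phi>) (modal_depth \<psi>)"
| "modal_depth (Disj \<phi> \<psi>) = max (modal_depth \<phi>) (modal_depth \<psi>)"
| "modal_depth (Dia \<phi>) = Suc (modal_depth \<phi>)"

primrec negation_free :: "'p ml \<Rightarrow> bool" where
  "negation_free Top \<longleftrightarrow> True"
| "negation_free Bot \<longleftrightarrow> True"
| "negation_free (Prop p) \<longleftrightarrow> True"
| "negation_free (Neg \<phi>) \<longleftrightarrow> False"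
| "negation_free (Conj \<phi> \<psi>) \<longleftrightarrow> negation_free \<phi> \<and> negation_free \<psi>"
| "negation_free (Disj \<phi> \<psi>) \<longleftrightarrow> negation_free \<phi> \<and> negation_free \<psi>"
| "negation_free (Dia \<phi>) \<longleftrightarrow> negation_free \<phi>"

record ('w, 'p) kripke =
  worlds :: "'w set"
  acc :: "('w \<times> 'w) set"
  val :: "'p \<Rightarrow> 'w set"

definition finite_model :: "'p set \<Rightarrow> ('w, 'p) kripke \<Rightarrow> bool" where
  "finite_model Props M \<longleftrightarrow>
     finite (worlds M) \<and> worlds M \<noteq> {} \<and> acc M \<subseteq> worlds M \<times> worlds M \<and>
     (\<forall>p\<in>Props. val M p \<subseteq> worlds M)"

definition finite_pointed_model :: "'p set \<Rightarrow> ('w, 'p) kripke \<Rightarrow> 'w \<Rightarrow> bool" where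
  "finite_pointed_model Props M w \<longleftrightarrow> finite_model Props M \<and> w \<in> worlds M"

primrec sat :: "('w, 'p) kripke \<Rightarrow> 'w \<Rightarrow> 'p ml \<Rightarrow> bool" where
  "sat M w Top \<longleftrightarrow> True"
| "sat M w Bot \<longleftrightarrow> False"
| "sat M w (Prop p) \<longleftrightarrow> w \<in> val M p"
| "sat M w (Neg \<phi>) \<longleftrightarrow> \<not> sat M w \<phi>"
| "sat M w (Conj \<phi> \<psi>) \<longleftrightarrow> sat M w \<phi> \<and> sat M w \<psi>"
| "sat M w (Disj \<phi> \<psi>) \<longleftrightarrow> sat M w \<phi> \<or> sat M w \<psi>"
| "sat M w (Dia \<phi>) \<longleftrightarrow> (\<exists>u. (w, u) \<in> acc M \<and> sat M u \<phi>)"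

definition homomorphism ::
  "'p set \<Rightarrow> ('w, 'p) kripke \<Rightarrow> 'w \<Rightarrow> ('v, 'p) kripke \<Rightarrow> 'v \<Rightarrow> ('w \<Rightarrow> 'v) \<Rightarrow> bool" where
  "homomorphism Props M w N v f \<longleftrightarrow>
     f ` worlds M \<subseteq> worlds N \<and> f w = v \<and>
     (\<forall>u z. (u, z) \<in> acc M \<longrightarrow> (f u, f z) \<in> acc N) \<and>
     (\<forall>p\<in>Props. \<forall>u. u \<in> val M p \<longrightarrow> f u \<in> val N p)"

definition injective_homomorphism ::
  "'p set \<Rightarrow> ('w, 'p) kripke \<Rightarrow> 'w \<Rightarrow> ('v, 'p) kripke \<Rightarrow> 'v \<Rightarrow> ('w \<Rightarrow> 'v) \<Rightarrow> bool" where
  "injective_homomorphism Props M w N v f \<longleftrightarrow> homomorphism Props M w N v f \<and> inj_on f (worlds M)"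

text \<open>
  HOL cannot quantify over types inside a formula, so the type from which worlds are drawn is an
  explicit argument of the next two notions.  For an infinite type every finite model has an
  isomorphic copy in it, hence nothing is lost.
\<close>

definition preserved_under_injective_homomorphisms ::
  "'w itself \<Rightarrow> 'p set \<Rightarrow> 'p ml \<Rightarrow> bool" where
  "preserved_under_injective_homomorphisms _ Props \<phi> \<longleftrightarrow>
     (\<forall>(M :: ('w, 'p) kripke) w (N :: ('w, 'p) kripke) v.
        finite_pointed_model Props M w \<longrightarrow> finite_pointed_model Props N v \<longrightarrow>
        sat M w \<phi> \<longrightarrow> (\<exists>f. injective_homomorphism Props M w N v f) \<longrightarrow> sat N v \<phi>)"

definition equivalent :: "'w itself \<Rightarrow> 'p set \<Rightarrow> 'p ml \<Rightarrow> 'p ml \<Rightarrow> bool" where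
  "equivalent _ Props \<phi> \<psi> \<longleftrightarrow>
     (\<forall>(M :: ('w, 'p) kripke) w. finite_pointed_model Props M w \<longrightarrow> (sat M w \<phi> \<longleftrightarrow> sat M w \<psi>))"

end

theory Submission imports Defs begin

text \<open>
  Up to modal depth \<open>L\<close> there are finitely many positive characteristic formulas, and a model \<open>N, v\<close>
  satisfies the one of \<open>M, w\<close> iff it simulates \<open>M, w\<close> for \<open>L\<close> steps.  It therefore suffices that
  \<open>\<phi>\<close> is preserved by such simulations.  For this, consider two models on the same worlds
  \<open>(m, n, i)\<close> with \<open>i \<le> L\<close>.  The smaller one moves along \<open>M\<close> and \<open>N\<close> simultaneously, decreasing \<open>i\<close> and
  keeping \<open>m\<close> simulated by \<open>n\<close> for \<open>i\<close> steps; the larger one moves along \<open>N\<close> and changes \<open>m\<close> and \<open>i\<close>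
  arbitrarily.  At \<open>(w, v, L)\<close> they are bisimilar for \<open>L\<close> steps to \<open>M, w\<close> and \<open>N, v\<close> respectively,
  and the identity is an injective homomorphism between them.
\<close>

section \<open>Bounded bisimulations and homomorphisms\<close>

lemma bounded_bisimulation_sat_iff:
  assumes atoms: "\<And>i x y p. Z i x y \<Longrightarrow> p \<in> Props \<Longrightarrow> x \<in> val M p \<longleftrightarrow> y \<in> val N p"
    and forward: "\<And>i x y x'. Z (Suc i) x y \<Longrightarrow> (x, x') \<in> acc M \<Longrightarrow> \<exists>y'. (y, y') \<in> acc N \<and> Z i x' y'"
    and backward: "\<And>i x y y'. Z (Suc i) x y \<Longrightarrow> (y, y') \<in> acc N \<Longrightarrow> \<exists>x'. (x, x') \<in> acc M \<and> Z i x' y'"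
    and "Z i x y" "props \<phi> \<subseteq> Props" "modal_depth \<phi> \<le> i"
  shows "sat M x \<phi> \<longleftrightarrow> sat N y \<phi>"
  using assms(4-6)
proof (induction \<phi> arbitrary: i x y)
  case (Dia \<phi>)
  \<comment> \<open>The depth of a diamond formula forces \<open>i\<close> to be a successor, the
    only case in which \<open>forward\<close> and \<open>backward\<close> apply. Hence worlds
    related at level 0 may have unmatched successors.\<close>
  then obtain j where j: "i = Suc j" "modal_depth \<phi> \<le> j"
    by (cases i) auto
  with Dia.prems have Z: "Z (Suc j) x y" and "props \<phi> \<subseteq> Props"
    by auto
  with Dia.IH j(2) have "sat M x' \<phi> \<longleftrightarrow> sat N y' \<phi>" if "Z j x' y'" for x' y'
    using that by blast
  then show ?case
    using forward[OF Z] backward[OF Z] by (metis sat.simps(7))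
qed (use atoms in \<open>force+\<close>)

lemma negation_free_sat_homomorphism:
  assumes "homomorphism Props M w N v f" "props \<psi> \<subseteq> Props" "negation_free \<psi>" "sat M u \<psi>"
  shows "sat N (f u) \<psi>"
  using assms(2-4) by (induction \<psi> arbitrary: u) (use assms(1) in \<open>(force simp: homomorphism_def)+\<close>)

section \<open>Changing the type of worlds\<close>

lemma finite_set_embedding:
  assumes "infinite (UNIV :: 'w set)" "finite A"
  obtains g :: "'a \<Rightarrow> 'w" where "inj_on g A"
proof -
  obtain B :: "'w set" where "finite B" "card B = card A"
    using infinite_arbitrarily_large[OF assms(1)] by blast
  with assms(2) obtain g where "bij_betw g A B"
    using finite_same_card_bij by metis
  then show thesis
    using that by (auto simp: bij_betw_def)
qed

definition image_model :: "('a \<Rightarrow> 'b) \<Rightarrow> ('a, 'p) kripke \<Rightarrow> ('b, 'p) kripke" where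
  "image_model g M =
     \<lparr>worlds = g ` worlds M, acc = map_prod g g ` acc M, val = \<lambda>p. g ` val M p\<rparr>"

lemma finite_pointed_image_model:
  "finite_pointed_model Props M w \<Longrightarrow> finite_pointed_model Props (image_model g M) (g w)"
  by (fastforce simp: finite_pointed_model_def finite_model_def image_model_def)

text \<open>The graph of \<open>g\<close> on \<open>worlds M\<close> is a bisimulation, so the index
  plays the role of a mere depth bound. Injectivity pulls membership in the image of the valuation
  and of the accessibility relation back to \<open>M\<close>.\<close>

lemma sat_image_model:
  assumes M: "finite_pointed_model Props M w" and g: "inj_on g (worlds M)"
    and \<phi>: "props \<phi> \<subseteq> Props"
  shows "sat (image_model g M) (g w) \<phi> \<longleftrightarrow> sat M w \<phi>"
proof -
  have acc: "x \<in> worlds M \<and> y \<in> worlds M" if "(x, y) \<in> acc M" for x y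
    using M that by (auto simp: finite_pointed_model_def finite_model_def)
  have val: "x \<in> worlds M" if "x \<in> val M p" "p \<in> Props" for x p
    using M that by (auto simp: finite_pointed_model_def finite_model_def)
  show ?thesis
  proof (rule bounded_bisimulation_sat_iff[where Z = "\<lambda>_ y x. x \<in> worlds M \<and> y = g x"
        and i = "modal_depth \<phi>" and Props = Props])
    show "x \<in> val (image_model g M) p \<longleftrightarrow> y \<in> val M p"
      if "y \<in> worlds M \<and> x = g y" "p \<in> Props" for x y p
      using that val g by (auto simp: image_model_def dest: inj_onD)
    show "\<exists>y'. (y, y') \<in> acc M \<and> y' \<in> worlds M \<and> x' = g y'"
      if "y \<in> worlds M \<and> x = g y" "(x, x') \<in> acc (image_model g M)" for x y x'
      using that acc g by (auto simp: image_model_def dest!: inj_onD)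
    show "\<exists>x'. (x, x') \<in> acc (image_model g M) \<and> y' \<in> worlds M \<and> x' = g y'"
      if "y \<in> worlds M \<and> x = g y" "(y, y') \<in> acc M" for x y y'
      using that acc by (force simp: image_model_def)
  qed (use M \<phi> in \<open>auto simp: finite_pointed_model_def\<close>)
qed

text \<open>The models built below have triples as worlds, whereas preservation is assumed over a
  single type \<open>'w\<close>. As the models are finite, both can be copied into \<open>'w\<close>
  by one injection \<open>g\<close>, and the homomorphism can be copied along with them.\<close>

lemma preserved_under_injective_homomorphisms_transfer:
  fixes Props :: "'p set"
  assumes inf: "infinite (UNIV :: 'w set)" and \<phi>: "props \<phi> \<subseteq> Props"
    and pres: "preserved_under_injective_homomorphisms TYPE('w) Props \<phi>"
  shows "preserved_under_injective_homomorphisms TYPE('a) Props \<phi>"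
  unfolding preserved_under_injective_homomorphisms_def
proof (intro allI impI, elim exE)
  fix M N :: "('a, 'p) kripke" and w v f
  assume M: "finite_pointed_model Props M w" and N: "finite_pointed_model Props N v"
    and sat: "sat M w \<phi>" and f: "injective_homomorphism Props M w N v f"
  have "finite (worlds M \<union> worlds N)"
    using M N by (auto simp: finite_pointed_model_def finite_model_def)
  then obtain g :: "'a \<Rightarrow> 'w" where "inj_on g (worlds M \<union> worlds N)"
    by (rule finite_set_embedding[OF inf])
  then have gM: "inj_on g (worlds M)" and gN: "inj_on g (worlds N)"
    by (auto simp: inj_on_Un)
  \<comment> \<open>\<open>h\<close> undoes \<open>g\<close> on \<open>worlds M\<close>, so
    \<open>g \<circ> f \<circ> h\<close> is \<open>f\<close> carried over to the copies. Its values
    outside the copy of \<open>worlds M\<close> do not matter, since edges and valuations over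
    \<open>Props\<close> stay inside.\<close>
  define h where "h = inv_into (worlds M) g"
  have h: "h (g x) = x" if "x \<in> worlds M" for x
    using gM that by (simp add: h_def)
  have "inj_on (g \<circ> f \<circ> h) (g ` worlds M)"
  proof (rule inj_onI, clarsimp simp: h)
    fix x y
    assume xy: "x \<in> worlds M" "y \<in> worlds M" "g (f x) = g (f y)"
    have "f ` worlds M \<subseteq> worlds N" "inj_on f (worlds M)"
      using f by (auto simp: injective_homomorphism_def homomorphism_def)
    with xy gN have "x = y"
      by (meson image_subset_iff inj_onD)
    then show "g x = g y"
      by simp
  qed
  moreover have "homomorphism Props (image_model g M) (g w) (image_model g N) (g v) (g \<circ> f \<circ> h)"
    unfolding homomorphism_def
  proof (intro conjI allI impI ballI)
    show "(g \<circ> f \<circ> h) ` worlds (image_model g M) \<subseteq> worlds (image_model g N)"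
      using f h by (auto simp: injective_homomorphism_def homomorphism_def image_model_def)
    show "(g \<circ> f \<circ> h) (g w) = g v"
      using f M h by (auto simp: injective_homomorphism_def homomorphism_def finite_pointed_model_def)
    show "((g \<circ> f \<circ> h) u, (g \<circ> f \<circ> h) z) \<in> acc (image_model g N)"
      if uz: "(u, z) \<in> acc (image_model g M)" for u z
    proof -
      obtain a b where ab: "(a, b) \<in> acc M" "u = g a" "z = g b"
        using uz by (auto simp: image_model_def)
      then have "a \<in> worlds M" "b \<in> worlds M"
        using M by (auto simp: finite_pointed_model_def finite_model_def)
      moreover have "(f a, f b) \<in> acc N"
        using ab f by (auto simp: injective_homomorphism_def homomorphism_def)
      ultimately show ?thesis
        using ab(2,3) h by (auto simp: image_model_def intro!: image_eqI[of _ _ "(f a, f b)"])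
    qed
    show "(g \<circ> f \<circ> h) u \<in> val (image_model g N) p"
      if p: "p \<in> Props" and u: "u \<in> val (image_model g M) p" for p u
    proof -
      obtain a where a: "a \<in> val M p" "u = g a"
        using u by (auto simp: image_model_def)
      then have "a \<in> worlds M"
        using M p by (auto simp: finite_pointed_model_def finite_model_def)
      moreover have "f a \<in> val N p"
        using a p f by (auto simp: injective_homomorphism_def homomorphism_def)
      ultimately show ?thesis
        using a h by (auto simp: image_model_def)
    qed
  qed
  ultimately have "injective_homomorphism Props (image_model g M) (g w) (image_model g N) (g v)
      (g \<circ> f \<circ> h)"
    by (simp add: injective_homomorphism_def image_model_def)
  moreover have "sat (image_model g M) (g w) \<phi>"
    using sat sat_image_model[OF M gM \<phi>] by simp
  ultimately have "sat (image_model g N) (g v) \<phi>"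
    using pres finite_pointed_image_model[OF M, of g] finite_pointed_image_model[OF N, of g]
    unfolding preserved_under_injective_homomorphisms_def by blast
  then show "sat N v \<phi>"
    using sat_image_model[OF N gN \<phi>] by simp
qed

section \<open>Finite conjunctions and disjunctions\<close>

definition list_of_set :: "'a set \<Rightarrow> 'a list" where
  "list_of_set S = (SOME xs. set xs = S)"

lemma set_list_of_set: "finite S \<Longrightarrow> set (list_of_set S) = S"
  unfolding list_of_set_def by (rule someI_ex) (rule finite_list)

text \<open>Fixing one enumeration per set makes the formula a function of the set, so that finitely
  many sets of conjuncts yield finitely many formulas, syntactically and not only up to
  equivalence.\<close>

definition big_conj :: "'p ml set \<Rightarrow> 'p ml" where
  "big_conj S = foldr Conj (list_of_set S) Top"

definition big_disj :: "'p ml set \<Rightarrow> 'p ml" where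
  "big_disj S = foldr Disj (list_of_set S) Bot"

lemma big_conj_simps:
  assumes "finite S"
  shows "sat M w (big_conj S) \<longleftrightarrow> (\<forall>\<phi>\<in>S. sat M w \<phi>)"
    and "props (big_conj S) = (\<Union>\<phi>\<in>S. props \<phi>)"
    and "negation_free (big_conj S) \<longleftrightarrow> (\<forall>\<phi>\<in>S. negation_free \<phi>)"
    and "modal_depth (big_conj S) \<le> k \<longleftrightarrow> (\<forall>\<phi>\<in>S. modal_depth \<phi> \<le> k)"
proof -
  have "sat M w (foldr Conj xs Top) \<longleftrightarrow> (\<forall>\<phi>\<in>set xs. sat M w \<phi>)"
    "props (foldr Conj xs Top) = (\<Union>\<phi>\<in>set xs. props \<phi>)"
    "negation_free (foldr Conj xs Top) \<longleftrightarrow> (\<forall>\<phi>\<in>set xs. negation_free \<phi>)"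
    "modal_depth (foldr Conj xs Top) \<le> k \<longleftrightarrow> (\<forall>\<phi>\<in>set xs. modal_depth \<phi> \<le> k)" for xs
    by (induction xs) auto
  then show "sat M w (big_conj S) \<longleftrightarrow> (\<forall>\<phi>\<in>S. sat M w \<phi>)"
    and "props (big_conj S) = (\<Union>\<phi>\<in>S. props \<phi>)"
    and "negation_free (big_conj S) \<longleftrightarrow> (\<forall>\<phi>\<in>S. negation_free \<phi>)"
    and "modal_depth (big_conj S) \<le> k \<longleftrightarrow> (\<forall>\<phi>\<in>S. modal_depth \<phi> \<le> k)"
    by (simp_all add: big_conj_def set_list_of_set[OF assms])
qed

lemma big_disj_simps:
  assumes "finite S"
  shows "sat M w (big_disj S) \<longleftrightarrow> (\<exists>\<phi>\<in>S. sat M w \<phi>)"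
    and "props (big_disj S) = (\<Union>\<phi>\<in>S. props \<phi>)"
    and "negation_free (big_disj S) \<longleftrightarrow> (\<forall>\<phi>\<in>S. negation_free \<phi>)"
    and "modal_depth (big_disj S) \<le> k \<longleftrightarrow> (\<forall>\<phi>\<in>S. modal_depth \<phi> \<le> k)"
proof -
  have "sat M w (foldr Disj xs Bot) \<longleftrightarrow> (\<exists>\<phi>\<in>set xs. sat M w \<phi>)"
    "props (foldr Disj xs Bot) = (\<Union>\<phi>\<in>set xs. props \<phi>)"
    "negation_free (foldr Disj xs Bot) \<longleftrightarrow> (\<forall>\<phi>\<in>set xs. negation_free \<phi>)"
    "modal_depth (foldr Disj xs Bot) \<le> k \<longleftrightarrow> (\<forall>\<phi>\<in>set xs. modal_depth \<phi> \<le> k)" for xs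
    by (induction xs) auto
  then show "sat M w (big_disj S) \<longleftrightarrow> (\<exists>\<phi>\<in>S. sat M w \<phi>)"
    and "props (big_disj S) = (\<Union>\<phi>\<in>S. props \<phi>)"
    and "negation_free (big_disj S) \<longleftrightarrow> (\<forall>\<phi>\<in>S. negation_free \<phi>)"
    and "modal_depth (big_disj S) \<le> k \<longleftrightarrow> (\<forall>\<phi>\<in>S. modal_depth \<phi> \<le> k)"
    by (simp_all add: big_disj_def set_list_of_set[OF assms])
qed

section \<open>Positive characteristic formulas\<close>

definition atomic_type :: "'p set \<Rightarrow> ('w, 'p) kripke \<Rightarrow> 'w \<Rightarrow> 'p ml" where
  "atomic_type Props M w = big_conj (Prop ` {p \<in> Props. w \<in> val M p})"

text \<open>This is the positive half of a Hintikka formula: no negated symbols, and no clause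
  bounding the successors from above. It therefore describes simulation rather than bisimulation for
  \<open>k\<close> steps.\<close>

primrec char_formula :: "'p set \<Rightarrow> ('w, 'p) kripke \<Rightarrow> nat \<Rightarrow> 'w \<Rightarrow> 'p ml" where
  "char_formula Props M 0 w = atomic_type Props M w"
| "char_formula Props M (Suc k) w =
     Conj (atomic_type Props M w) (big_conj (Dia ` char_formula Props M k ` (acc M `` {w})))"

text \<open>A formula of level \<open>Suc k\<close> is determined by a subset of
  \<open>Props\<close> and a set of formulas of level \<open>k\<close>, so finiteness passes from
  each level to the next through power sets.\<close>

lemma finite_char_formulas:
  assumes "finite Props"
  shows "finite {char_formula Props M k w |(M :: ('w, 'p) kripke) w. True}"
proof (induction k)
  case 0
  have "{char_formula Props M 0 w |(M :: ('w, 'p) kripke) w. True}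
      \<subseteq> (\<lambda>P. big_conj (Prop ` P)) ` Pow Props"
    by (auto simp: atomic_type_def)
  then show ?case
    using assms finite_subset by blast
next
  case (Suc k)
  let ?D = "{char_formula Props M k w |(M :: ('w, 'p) kripke) w. True}"
  have "{char_formula Props M (Suc k) w |(M :: ('w, 'p) kripke) w. True}
      \<subseteq> (\<lambda>(P, S). Conj (big_conj (Prop ` P)) (big_conj (Dia ` S))) ` (Pow Props \<times> Pow ?D)"
  proof clarify
    fix M :: "('w, 'p) kripke" and w
    show "char_formula Props M (Suc k) w
        \<in> (\<lambda>(P, S). Conj (big_conj (Prop ` P)) (big_conj (Dia ` S))) ` (Pow Props \<times> Pow ?D)"
      by (rule image_eqI[where x = "({p \<in> Props. w \<in> val M p},
            char_formula Props M k ` (acc M `` {w}))"]) (auto simp: atomic_type_def)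
  qed
  moreover have "finite (Pow Props \<times> Pow ?D)"
    using assms Suc by simp
  ultimately show ?case
    using finite_subset by blast
qed

context
  fixes Props :: "'p set" and M :: "('w, 'p) kripke"
  assumes finite_Props: "finite Props" and M: "finite_model Props M"
begin

lemma finite_successors: "finite (acc M `` {w})"
proof (rule finite_subset)
  show "acc M `` {w} \<subseteq> worlds M" "finite (worlds M)"
    using M by (auto simp: finite_model_def)
qed

lemma sat_atomic_type:
  "sat N v (atomic_type Props M w) \<longleftrightarrow> (\<forall>p\<in>Props. w \<in> val M p \<longrightarrow> v \<in> val N p)"
  using finite_Props by (auto simp: atomic_type_def big_conj_simps)

lemma sat_char_formula_Suc:
  "sat N v (char_formula Props M (Suc k) w) \<longleftrightarrow>
     sat N v (atomic_type Props M w) \<and>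
     (\<forall>w'. (w, w') \<in> acc M \<longrightarrow> (\<exists>v'. (v, v') \<in> acc N \<and> sat N v' (char_formula Props M k w')))"
  using finite_successors by (auto simp: big_conj_simps)

lemma char_formula_imp_atomic_type:
  "sat N v (char_formula Props M k w) \<Longrightarrow> sat N v (atomic_type Props M w)"
  by (cases k) auto

lemma sat_char_formula_self: "sat M w (char_formula Props M k w)"
proof (induction k arbitrary: w)
  case 0
  show ?case by (simp add: sat_atomic_type)
next
  case (Suc k)
  then show ?case unfolding sat_char_formula_Suc by (auto simp: sat_atomic_type)
qed

lemma char_formula_positive:
  "props (char_formula Props M k w) \<subseteq> Props \<and> negation_free (char_formula Props M k w) \<and>
     modal_depth (char_formula Props M k w) \<le> k"
proof -
  have atom: "props (atomic_type Props M u) \<subseteq> Props \<and> negation_free (atomic_type Props M u) \<and>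
      modal_depth (atomic_type Props M u) \<le> j" for u j
    using finite_Props by (auto simp: atomic_type_def big_conj_simps)
  show ?thesis
  proof (induction k arbitrary: w)
    case 0
    show ?case using atom[of w 0] by simp
  next
    case (Suc k)
    have "finite (Dia ` char_formula Props M k ` (acc M `` {w}))"
      using finite_successors by simp
    with Suc atom[of w "Suc k"] show ?case
      by (simp add: big_conj_simps UN_subset_iff)
  qed
qed

section \<open>From bounded simulation to an injective homomorphism\<close>

lemma preserved_sat_of_char_formula:
  fixes N :: "('v, 'p) kripke"
  assumes pres: "preserved_under_injective_homomorphisms TYPE('w \<times> 'v \<times> nat) Props \<phi>"
    and \<phi>: "props \<phi> \<subseteq> Props" "modal_depth \<phi> \<le> L"
    and w: "w \<in> worlds M" and N: "finite_pointed_model Props N v"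
    and sat: "sat M w \<phi>" and char: "sat N v (char_formula Props M L w)"
  shows "sat N v \<phi>"
proof -
  define W where "W = worlds M \<times> worlds N \<times> {..L}"
  \<comment> \<open>The counter records how many steps of simulation remain, and an edge must lead
    to a pair still simulated for that many steps. Intersecting the valuations keeps
    \<open>M'\<close> below \<open>N'\<close>; where the simulation holds, the intersection agrees
    on \<open>Props\<close> with the valuation of \<open>M\<close>.\<close>
  define M' where "M' = \<lparr>worlds = W,
    acc = {((m, n, i), (m', n', j)). (m, n, i) \<in> W \<and> (m', n', j) \<in> W \<and>
      (m, m') \<in> acc M \<and> (n, n') \<in> acc N \<and> i = Suc j \<and> sat N n' (char_formula Props M j m')},
    val = \<lambda>p. {(m, n, i). (m, n, i) \<in> W \<and> m \<in> val M p \<and> n \<in> val N p}\<rparr>"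
  \<comment> \<open>Dropping every condition on the first and third components only adds edges and
    true atoms, and makes \<open>N'\<close> look like \<open>N\<close> through the second
    component.\<close>
  define N' where "N' = \<lparr>worlds = W,
    acc = {((m, n, i), (m', n', j)). (m, n, i) \<in> W \<and> (m', n', j) \<in> W \<and> (n, n') \<in> acc N},
    val = \<lambda>p. {(m, n, i). (m, n, i) \<in> W \<and> n \<in> val N p}\<rparr>"
  have accM: "m' \<in> worlds M" if "(m, m') \<in> acc M" for m m'
    using M that by (auto simp: finite_model_def)
  have accN: "n' \<in> worlds N" if "(n, n') \<in> acc N" for n n'
    using N that by (auto simp: finite_pointed_model_def finite_model_def)
  have start: "(w, v, L) \<in> W" and "finite W"
    using w M N by (auto simp: W_def finite_pointed_model_def finite_model_def)
  then have M': "finite_pointed_model Props M' (w, v, L)"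
    and N': "finite_pointed_model Props N' (w, v, L)"
    by (auto simp: finite_pointed_model_def finite_model_def M'_def N'_def)
  have id: "injective_homomorphism Props M' (w, v, L) N' (w, v, L) id"
    by (auto simp: injective_homomorphism_def homomorphism_def M'_def N'_def)
  have "sat M' (w, v, L) \<phi> \<longleftrightarrow> sat M w \<phi>"
  \<comment> \<open>The index of the bisimulation is the counter stored in the world, so the lack of
    edges of \<open>M'\<close> at counter 0 does no harm.\<close>
  proof (rule bounded_bisimulation_sat_iff[where i = L and Props = Props and
        Z = "\<lambda>i x m. \<exists>n. x = (m, n, i) \<and> x \<in> W \<and> sat N n (char_formula Props M i m)"])
    show "x \<in> val M' p \<longleftrightarrow> m \<in> val M p"
      if "\<exists>n. x = (m, n, i) \<and> x \<in> W \<and> sat N n (char_formula Props M i m)" "p \<in> Props" for i x m p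
      using that char_formula_imp_atomic_type sat_atomic_type by (fastforce simp: M'_def)
    show "\<exists>m'. (m, m') \<in> acc M \<and>
        (\<exists>n. x' = (m', n, i) \<and> x' \<in> W \<and> sat N n (char_formula Props M i m'))"
      if "\<exists>n. x = (m, n, Suc i) \<and> x \<in> W \<and> sat N n (char_formula Props M (Suc i) m)"
        "(x, x') \<in> acc M'" for i x m x'
      using that by (auto simp: M'_def)
    show "\<exists>x'. (x, x') \<in> acc M' \<and>
        (\<exists>n. x' = (m', n, i) \<and> x' \<in> W \<and> sat N n (char_formula Props M i m'))"
      if x: "\<exists>n. x = (m, n, Suc i) \<and> x \<in> W \<and> sat N n (char_formula Props M (Suc i) m)"
        and m': "(m, m') \<in> acc M" for i x m m'
    proof -
      obtain n where n: "x = (m, n, Suc i)" "x \<in> W" "sat N n (char_formula Props M (Suc i) m)"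
        using x by blast
      \<comment> \<open>The diamond conjunct for \<open>m'\<close> in the formula at level
        \<open>Suc i\<close> supplies an \<open>n'\<close> simulating \<open>m'\<close> for
        \<open>i\<close> steps, which is exactly what an edge of \<open>M'\<close> requires.\<close>
      then obtain n' where n': "(n, n') \<in> acc N" "sat N n' (char_formula Props M i m')"
        using m' unfolding sat_char_formula_Suc by blast
      moreover have "(m', n', i) \<in> W"
        using n accM[OF m'] accN[OF n'(1)] by (auto simp: W_def)
      ultimately show ?thesis
        using n m' by (intro exI[of _ "(m', n', i)"]) (auto simp: M'_def)
    qed
  qed (use start char \<phi> in auto)
  with sat M' N' id pres have "sat N' (w, v, L) \<phi>"
    unfolding preserved_under_injective_homomorphisms_def by blast
  also have "sat N' (w, v, L) \<phi> \<longleftrightarrow> sat N v \<phi>"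
  \<comment> \<open>Here the relation is independent of the index: projection to the second
    component is a full bisimulation. An edge of \<open>N\<close> is lifted by keeping
    \<open>m\<close> and the counter unchanged.\<close>
  proof (rule bounded_bisimulation_sat_iff[where i = L and Props = Props and
        Z = "\<lambda>_ x n. \<exists>m i. x = (m, n, i) \<and> x \<in> W"])
    show "\<exists>x'. (x, x') \<in> acc N' \<and> (\<exists>m i. x' = (m, n', i) \<and> x' \<in> W)"
      if x: "\<exists>m i. x = (m, n, i) \<and> x \<in> W" and n': "(n, n') \<in> acc N" for x n n'
    proof -
      obtain m i where "x = (m, n, i)" "x \<in> W"
        using x by blast
      with n' accN[OF n'] show ?thesis
        by (intro exI[of _ "(m, n', i)"]) (auto simp: N'_def W_def)
    qed
  qed (use start \<phi> in \<open>auto simp: N'_def\<close>)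
  finally show ?thesis .
qed

end

section \<open>The preservation theorem\<close>

theorem theorem4p12:
  fixes Props :: "'p set" and \<phi> :: "'p ml" and L :: nat
  assumes "infinite (UNIV :: 'w set)"
    and "finite Props"
    and "props \<phi> \<subseteq> Props"
    and "modal_depth \<phi> \<le> L"
  shows "preserved_under_injective_homomorphisms TYPE('w) Props \<phi> \<longleftrightarrow>
    (\<exists>\<psi>. props \<psi> \<subseteq> Props \<and> negation_free \<psi> \<and> modal_depth \<psi> \<le> L \<and> equivalent TYPE('w) Props \<phi> \<psi>)"
proof
  assume pres: "preserved_under_injective_homomorphisms TYPE('w) Props \<phi>"
  have pres': "preserved_under_injective_homomorphisms TYPE('w \<times> 'w \<times> nat) Props \<phi>"
    by (rule preserved_under_injective_homomorphisms_transfer[OF assms(1,3) pres])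
  \<comment> \<open>Infinitely many pointed models may satisfy \<open>\<phi>\<close>, but they
    contribute finitely many formulas, so their disjunction is a formula. If no model satisfies
    \<open>\<phi>\<close>, it is \<open>Bot\<close>.\<close>
  define S where "S = {char_formula Props M L w |(M :: ('w, 'p) kripke) w.
    finite_pointed_model Props M w \<and> sat M w \<phi>}"
  have S: "finite S"
    by (rule finite_subset[OF _ finite_char_formulas[OF assms(2), where 'w = 'w and k = L]])
      (auto simp: S_def)
  have "props \<chi> \<subseteq> Props \<and> negation_free \<chi> \<and> modal_depth \<chi> \<le> L" if \<chi>: "\<chi> \<in> S" for \<chi>
  proof -
    obtain M :: "('w, 'p) kripke" and w where "finite_model Props M" "\<chi> = char_formula Props M L w"
      using \<chi> by (auto simp: S_def finite_pointed_model_def)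
    then show ?thesis
      using char_formula_positive[OF assms(2)] by simp
  qed
  then have "props (big_disj S) \<subseteq> Props" "negation_free (big_disj S)" "modal_depth (big_disj S) \<le> L"
    using S by (auto simp: big_disj_simps)
  moreover have "equivalent TYPE('w) Props \<phi> (big_disj S)"
    unfolding equivalent_def big_disj_simps[OF S]
  proof (intro allI impI iffI)
    fix N :: "('w, 'p) kripke" and v
    assume N: "finite_pointed_model Props N v"
    show "\<exists>\<chi>\<in>S. sat N v \<chi>" if "sat N v \<phi>"
    \<comment> \<open>A model of \<open>\<phi>\<close> satisfies its own characteristic formula,
      which is one of the disjuncts.\<close>
    proof (rule bexI[of _ "char_formula Props N L v"])
      show "sat N v (char_formula Props N L v)"
        using N by (intro sat_char_formula_self[OF assms(2)]) (simp add: finite_pointed_model_def)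
      show "char_formula Props N L v \<in> S"
        using N that by (auto simp: S_def)
    qed
    show "sat N v \<phi>" if ex: "\<exists>\<chi>\<in>S. sat N v \<chi>"
    proof -
      obtain M :: "('w, 'p) kripke" and w where "finite_pointed_model Props M w" "sat M w \<phi>"
        "sat N v (char_formula Props M L w)"
        using ex by (auto simp: S_def)
      then show ?thesis
        using preserved_sat_of_char_formula[OF assms(2) _ pres' assms(3,4) _ N]
        by (auto simp: finite_pointed_model_def)
    qed
  qed
  ultimately show "\<exists>\<psi>. props \<psi> \<subseteq> Props \<and> negation_free \<psi> \<and> modal_depth \<psi> \<le> L \<and>
      equivalent TYPE('w) Props \<phi> \<psi>"
    by blast
next
  assume "\<exists>\<psi>. props \<psi> \<subseteq> Props \<and> negation_free \<psi> \<and> modal_depth \<psi> \<le> L \<and>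
      equivalent TYPE('w) Props \<phi> \<psi>"
  then obtain \<psi> where \<psi>: "props \<psi> \<subseteq> Props" "negation_free \<psi>" "equivalent TYPE('w) Props \<phi> \<psi>"
    by blast
  show "preserved_under_injective_homomorphisms TYPE('w) Props \<phi>"
    unfolding preserved_under_injective_homomorphisms_def
  proof (intro allI impI, elim exE)
    fix M N :: "('w, 'p) kripke" and w v f
    assume M: "finite_pointed_model Props M w" and N: "finite_pointed_model Props N v"
      and "sat M w \<phi>" and f: "injective_homomorphism Props M w N v f"
    \<comment> \<open>Truth passes from \<open>\<phi>\<close> to \<open>\<psi>\<close> in
      \<open>M\<close>, along \<open>f\<close> to \<open>N\<close>, and back to
      \<open>\<phi>\<close> there.\<close>
    then have "sat M w \<psi>"
      using \<psi>(3) by (auto simp: equivalent_def)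
    with f \<psi> have "sat N (f w) \<psi>"
      unfolding injective_homomorphism_def by (blast intro: negation_free_sat_homomorphism)
    moreover have "f w = v"
      using f by (auto simp: injective_homomorphism_def homomorphism_def)
    ultimately show "sat N v \<phi>"
      using \<psi>(3) N by (auto simp: equivalent_def)
  qed
qed

end
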